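(* Let $m=2k+1$ be an odd positive integer ($k\ge 0$ an integer), let $\beta=\frac{k+1+\sqrt{k^{2}+6k+5}}{2}$, and let $$\mathcal{S}=\left\{\frac{p\beta+q}{(k+1)^{n}} : n,p,q\in\mathbb{Z}\right\}\cap\left(0,\frac{m}{\beta-1}\right).$$ Then every element $x\in\mathcal{S}$ has countably many expansions (i.e. $\mathcal{E}_{\beta,m}(x)$ has cardinality $\aleph_0$), while every $x\in(0,\beta-k)\setminus\mathcal{S}$ has uncountably many expansions (i.e. $\mathcal{E}_{\beta,m}(x)$ is uncountable).
   Context: For a positive integer $m$, a base $\beta\in(1,m+1]$ and $x\in[0,\frac{m}{\beta-1}]$, an expansion of $x$ is a sequence $(\varepsilon_i)_{i\ge1}\in\{0,1,\ldots,m\}^{\infty}$ (all infinite sequences of digits in $\{0,\ldots,m\}$) with $x=\sum_{i=1}^{\infty}\varepsilon_i\beta^{-i}$. The set of all expansions of $x$ is $$\mathcal{E}_{\beta,m}(x)=\left\{(\varepsilon_i)_{i=1}^{\infty}\in\{0,1,\ldots,m\}^{\infty} : x=\sum_{i=1}^{\infty}\frac{\varepsilon_i}{\beta^i}\right\}.$$ For $m=2k+1$ and $\beta=\frac{k+1+\sqrt{k^{2}+6k+5}}{2}$ (the generalized golden ratio $\mathcal{G}(m)$), one has $\frac{k+1}{\beta}+\frac{k+1}{\beta^2}=1$ and $\frac{m}{\beta-1}=\beta-k$. *)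

theory Defs
  imports Complex_Main "HOL-Library.Countable_Set" "HOL-Library.Equipollence"
begin

text \<open>
  Digit sequences are indexed from 0, so \<open>\<epsilon> i\<close> is the digit at \<open>\<beta>\<close> to the power \<open>-(i+1)\<close>;
  this way every sequence is a single function, without an irrelevant value at index 0.
\<close>

definition expansions :: "real \<Rightarrow> nat \<Rightarrow> real \<Rightarrow> (nat \<Rightarrow> nat) set" where
  "expansions \<beta> m x =
     {\<epsilon>. (\<forall>i. \<epsilon> i \<le> m) \<and> (\<lambda>i. real (\<epsilon> i) / \<beta> ^ Suc i) sums x}"

end

theory Submission
  imports Defs
begin

text \<open>
  Put \<open>L = \<beta> - k = m / (\<beta> - 1)\<close>. Appending a digit \<open>i\<close> replaces the part \<open>y\<close> of \<open>x\<close> that is still to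
  be expanded by \<open>\<beta> * y - i\<close>, and a digit sequence is an expansion iff all these remainders stay in
  \<open>{0..L}\<close>. So expansions are orbits, and the question is how often an orbit has a choice. As
  \<open>1 < L < 2\<close>, there are never more than two choices, and two of them exist iff \<open>\<beta> * y - i\<close> lies in
  \<open>{1..L}\<close> for some \<open>i < m\<close>. The special value of \<open>\<beta>\<close> enters through \<open>\<beta> * (L - 1) = k + 1\<close>: a
  point with only one choice that is not too close to an end of \<open>{0..L}\<close> is sent into the interval
  between \<open>L - 1\<close> and \<open>1\<close>, all of whose points have two. Near the ends the distance to the end is multiplied by \<open>\<beta>\<close>.
  Hence every orbit in the open interval meets choices again and again
  (\<open>interior_orbit_branches\<close>), and every expansion with such an orbit is a limit of other
  expansions of the same number (\<open>nearby_expansion\<close>). In particular every interior \<open>x\<close> has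
  infinitely many expansions.

  Up to the restriction to the open interval, \<open>S\<close> is the ring \<open>\<int>[\<beta>, 1 / (k + 1)]\<close>, in which \<open>\<beta>\<close> is
  a unit. If \<open>x\<close> is outside this ring, then so are all its remainders; they never equal \<open>0\<close> or
  \<open>L\<close>, so no expansion of \<open>x\<close> is isolated. The set of expansions is then nonempty, closed and
  perfect, hence uncountable (\<open>uncountable_perfect_sequence_set\<close>).

  If \<open>x\<close> is in the ring, then all remainders from some point on have the form \<open>p * \<beta> + q\<close> with
  integers \<open>p\<close> and \<open>q\<close>. The coefficient of \<open>\<beta>\<close> evolves by \<open>p' = y - (L - 1) * p\<close>, and since
  \<open>0 \<le> y \<le> L < 2\<close> and \<open>p'\<close> is an integer, \<open>\<bar>2 * p - 1\<bar>\<close> cannot increase. Once it is constant, \<open>p\<close>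
  is constant or alternates with \<open>1 - p\<close>, so the digits have period 2 from then on
  (\<open>integral_orbit_eventually_periodic\<close>). There are only countably many eventually periodic
  digit sequences.
\<close>

section \<open>Expansions and their remainders\<close>

primrec remainder :: "real \<Rightarrow> (nat \<Rightarrow> nat) \<Rightarrow> real \<Rightarrow> nat \<Rightarrow> real" where
  "remainder \<beta> \<epsilon> x 0 = x"
| "remainder \<beta> \<epsilon> x (Suc n) = \<beta> * remainder \<beta> \<epsilon> x n - real (\<epsilon> n)"

lemma remainder_eq_tail:
  assumes "\<beta> \<noteq> 0"
  shows "remainder \<beta> \<epsilon> x n = \<beta> ^ n * (x - (\<Sum>i<n. real (\<epsilon> i) / \<beta> ^ Suc i))"
proof (induction n)
  case (Suc n)
  have "\<beta> ^ Suc n * (real (\<epsilon> n) / \<beta> ^ Suc n) = real (\<epsilon> n)"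
    using assms by simp
  with Suc show ?case
    unfolding remainder.simps sum.lessThan_Suc diff_diff_add[symmetric] right_diff_distrib
    by (simp add: mult.assoc right_diff_distrib)
qed simp

lemma remainder_cong:
  "(\<And>i. i < n \<Longrightarrow> \<epsilon> i = \<delta> i) \<Longrightarrow> remainder \<beta> \<epsilon> x n = remainder \<beta> \<delta> x n"
  by (induction n) auto

lemma remainder_add:
  "remainder \<beta> \<epsilon> x (t + n) = remainder \<beta> (\<lambda>i. \<epsilon> (t + i)) (remainder \<beta> \<epsilon> x t) n"
  by (induction n) auto

lemma geometric_digit_sums:
  fixes \<beta> :: real
  assumes "\<beta> > 1"
  shows "(\<lambda>i. c / \<beta> ^ Suc i) sums (c / (\<beta> - 1))"
proof -
  have "(\<lambda>i. (1 / \<beta>) ^ i) sums (1 / (1 - 1 / \<beta>))"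
    by (rule geometric_sums) (use assms in auto)
  then have "(\<lambda>i. c / \<beta> * (1 / \<beta>) ^ i) sums (c / \<beta> * (1 / (1 - 1 / \<beta>)))"
    by (rule sums_mult)
  moreover have "c / \<beta> * (1 / (1 - 1 / \<beta>)) = c / (\<beta> - 1)"
    using assms by (simp add: field_simps)
  moreover have "c / \<beta> * (1 / \<beta>) ^ i = c / \<beta> ^ Suc i" for i
    by (simp add: power_one_over)
  ultimately show ?thesis
    by (simp only:)
qed

lemma expansion_value_bounds:
  assumes "\<beta> > 1" "\<epsilon> \<in> expansions \<beta> m x"
  shows "0 \<le> x" "x \<le> real m / (\<beta> - 1)"
proof -
  have s: "(\<lambda>i. real (\<epsilon> i) / \<beta> ^ Suc i) sums x" and d: "\<And>i. \<epsilon> i \<le> m"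
    using assms(2) by (auto simp: expansions_def)
  show "0 \<le> x"
    by (rule sums_le[OF _ sums_zero s]) (use assms(1) in auto)
  show "x \<le> real m / (\<beta> - 1)"
    by (rule sums_le[OF _ s geometric_digit_sums[OF assms(1)]])
      (use assms(1) d in \<open>auto intro!: divide_right_mono\<close>)
qed

lemma expansions_shift:
  assumes "\<beta> > 1" "\<epsilon> \<in> expansions \<beta> m x"
  shows "(\<lambda>i. \<epsilon> (n + i)) \<in> expansions \<beta> m (remainder \<beta> \<epsilon> x n)"
proof -
  have s: "(\<lambda>i. real (\<epsilon> i) / \<beta> ^ Suc i) sums x" and d: "\<And>i. \<epsilon> i \<le> m"
    using assms(2) by (auto simp: expansions_def)
  have "(\<lambda>i. real (\<epsilon> (i + n)) / \<beta> ^ Suc (i + n)) sums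
          (x - (\<Sum>i<n. real (\<epsilon> i) / \<beta> ^ Suc i))"
    using s by (subst sums_iff_shift) simp
  then have "(\<lambda>i. \<beta> ^ n * (real (\<epsilon> (i + n)) / \<beta> ^ Suc (i + n))) sums
          (\<beta> ^ n * (x - (\<Sum>i<n. real (\<epsilon> i) / \<beta> ^ Suc i)))"
    by (rule sums_mult)
  moreover have "\<beta> ^ n * (real (\<epsilon> (i + n)) / \<beta> ^ Suc (i + n)) = real (\<epsilon> (n + i)) / \<beta> ^ Suc i" for i
    using assms(1) by (simp add: power_add field_simps)
  ultimately show ?thesis
    using d assms(1) remainder_eq_tail[of \<beta> \<epsilon> x n] by (simp add: expansions_def)
qed

text \<open>
  The remainder after \<open>n\<close> digits is \<open>\<beta> ^ n\<close> times the error of the \<open>n\<close>-th partial sum. So bounded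
  remainders force the partial sums to converge, and conversely each remainder is itself the value
  of a digit sequence. This turns expansions into orbits of the maps \<open>y \<mapsto> \<beta> * y - i\<close>.
\<close>

lemma expansions_iff_remainders:
  assumes "\<beta> > 1"
  shows "\<epsilon> \<in> expansions \<beta> m x \<longleftrightarrow>
           (\<forall>i. \<epsilon> i \<le> m) \<and> (\<forall>n. remainder \<beta> \<epsilon> x n \<in> {0..real m / (\<beta> - 1)})"
proof
  assume e: "\<epsilon> \<in> expansions \<beta> m x"
  then show "(\<forall>i. \<epsilon> i \<le> m) \<and> (\<forall>n. remainder \<beta> \<epsilon> x n \<in> {0..real m / (\<beta> - 1)})"
    using expansion_value_bounds[OF assms expansions_shift[OF assms e]]
    by (auto simp: expansions_def)
next
  assume r: "(\<forall>i. \<epsilon> i \<le> m) \<and> (\<forall>n. remainder \<beta> \<epsilon> x n \<in> {0..real m / (\<beta> - 1)})"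
  let ?s = "\<lambda>n. \<Sum>i<n. real (\<epsilon> i) / \<beta> ^ Suc i"
  have eq: "x - ?s n = remainder \<beta> \<epsilon> x n / \<beta> ^ n" for n
    using assms remainder_eq_tail[of \<beta> \<epsilon> x n] by simp
  have lim: "(\<lambda>n. real m / (\<beta> - 1) * (1 / \<beta>) ^ n) \<longlonglongrightarrow> real m / (\<beta> - 1) * 0"
    using assms by (intro tendsto_mult tendsto_const LIMSEQ_power_zero) auto
  have "(\<lambda>n. x - ?s n) \<longlonglongrightarrow> 0"
  proof (rule tendsto_sandwich[OF _ _ tendsto_const])
    show "\<forall>\<^sub>F n in sequentially. 0 \<le> x - ?s n"
      using r assms unfolding eq by (auto intro!: always_eventually)
    show "\<forall>\<^sub>F n in sequentially. x - ?s n \<le> real m / (\<beta> - 1) * (1 / \<beta>) ^ n"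
    proof (intro always_eventually allI)
      fix n
      have "remainder \<beta> \<epsilon> x n / \<beta> ^ n \<le> real m / (\<beta> - 1) / \<beta> ^ n"
        using r assms by (intro divide_right_mono) auto
      then show "x - ?s n \<le> real m / (\<beta> - 1) * (1 / \<beta>) ^ n"
        unfolding eq by (simp add: power_one_over)
    qed
    show "(\<lambda>n. real m / (\<beta> - 1) * (1 / \<beta>) ^ n) \<longlonglongrightarrow> 0"
      using lim by simp
  qed
  then have "(\<lambda>n. x - (x - ?s n)) \<longlonglongrightarrow> x - 0"
    by (intro tendsto_diff tendsto_const)
  then show "\<epsilon> \<in> expansions \<beta> m x"
    using r by (simp add: expansions_def sums_def)
qed

lemma splice_expansion:
  assumes "\<beta> > 1" "\<epsilon> \<in> expansions \<beta> m x" "\<delta> \<in> expansions \<beta> m (remainder \<beta> \<epsilon> x t)"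
  shows "(\<lambda>i. if i < t then \<epsilon> i else \<delta> (i - t)) \<in> expansions \<beta> m x" (is "?\<gamma> \<in> _")
proof -
  have low: "remainder \<beta> ?\<gamma> x n = remainder \<beta> \<epsilon> x n" if "n \<le> t" for n
    using that by (intro remainder_cong) auto
  have "remainder \<beta> ?\<gamma> x n \<in> {0..real m / (\<beta> - 1)}" for n
  proof (cases "n \<le> t")
    case True
    then show ?thesis
      using low assms(1,2) by (simp add: expansions_iff_remainders del: atLeastAtMost_iff)
  next
    case False
    then obtain j where n: "n = t + j"
      using le_Suc_ex nat_le_linear by blast
    have "remainder \<beta> ?\<gamma> x n = remainder \<beta> \<delta> (remainder \<beta> \<epsilon> x t) j"
      unfolding n remainder_add low[OF order_refl] by simp
    then show ?thesis
      using assms(1,3) by (simp add: expansions_iff_remainders del: atLeastAtMost_iff)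
  qed
  then show ?thesis
    using assms by (auto simp: expansions_iff_remainders)
qed

lemma expansion_Cons:
  assumes "\<beta> > 1" "d \<le> m" "\<delta> \<in> expansions \<beta> m (\<beta> * y - real d)"
    and "y \<in> {0..real m / (\<beta> - 1)}"
  shows "case_nat d \<delta> \<in> expansions \<beta> m y"
proof -
  have "remainder \<beta> (case_nat d \<delta>) y (Suc n) = remainder \<beta> \<delta> (\<beta> * y - real d) n" for n
    using remainder_add[of \<beta> "case_nat d \<delta>" y 1 n] by simp
  then have "remainder \<beta> (case_nat d \<delta>) y n \<in> {0..real m / (\<beta> - 1)}" for n
    using assms by (cases n) (auto simp: expansions_iff_remainders)
  then show ?thesis
    using assms by (auto simp: expansions_iff_remainders split: nat.split)
qed

lemma digits_remaining_in:
  assumes step: "\<And>y. y \<in> Y \<Longrightarrow> \<exists>i\<le>m. \<beta> * y - real i \<in> Y" and "x \<in> Y"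
  obtains \<epsilon> where "\<And>i. \<epsilon> i \<le> m" "\<And>n. remainder \<beta> \<epsilon> x n \<in> Y"
proof -
  obtain d where d: "\<And>y. y \<in> Y \<Longrightarrow> d y \<le> m \<and> \<beta> * y - real (d y) \<in> Y"
    using step by metis
  define r where "r = rec_nat x (\<lambda>_ y. \<beta> * y - real (d y))"
  have [simp]: "r 0 = x" "r (Suc n) = \<beta> * r n - real (d (r n))" for n
    by (simp_all add: r_def)
  have r: "r n \<in> Y" for n
    by (induction n) (use d \<open>x \<in> Y\<close> in auto)
  have "remainder \<beta> (\<lambda>n. d (r n)) x n = r n" for n
    by (induction n) auto
  then show ?thesis
    using that[of "\<lambda>n. d (r n)"] r d by auto
qed

lemma expansions_closed:
  assumes "\<beta> > 1" and approx: "\<And>N. \<exists>\<delta>\<in>expansions \<beta> m x. \<forall>i<N. \<delta> i = \<epsilon> i"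
  shows "\<epsilon> \<in> expansions \<beta> m x"
proof -
  have "\<epsilon> n \<le> m \<and> remainder \<beta> \<epsilon> x n \<in> {0..real m / (\<beta> - 1)}" for n
  proof -
    obtain \<delta> where \<delta>: "\<delta> \<in> expansions \<beta> m x" "\<forall>i<Suc n. \<delta> i = \<epsilon> i"
      using approx by blast
    have "remainder \<beta> \<delta> x n = remainder \<beta> \<epsilon> x n" "\<delta> n = \<epsilon> n"
      using \<delta>(2) by (auto intro!: remainder_cong)
    then show ?thesis
      using \<delta>(1) assms(1) expansions_iff_remainders by metis
  qed
  then show ?thesis
    using assms(1) by (simp add: expansions_iff_remainders)
qed

section \<open>Sets of sequences\<close>

text \<open>
  Cantor's diagonal argument along prefixes: given an enumeration of \<open>A\<close>, perfectness allows moving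
  off its \<open>n\<close>-th member without disturbing a prefix that is already fixed, and closedness keeps the
  sequence determined by the growing prefixes inside \<open>A\<close>.
\<close>

lemma uncountable_perfect_sequence_set:
  fixes A :: "(nat \<Rightarrow> 'a) set"
  assumes nonempty: "A \<noteq> {}"
    and closed: "\<And>\<epsilon>. (\<And>N. \<exists>\<delta>\<in>A. \<forall>i<N. \<delta> i = \<epsilon> i) \<Longrightarrow> \<epsilon> \<in> A"
    and perfect: "\<And>\<epsilon> N. \<epsilon> \<in> A \<Longrightarrow> \<exists>\<delta>\<in>A. \<delta> \<noteq> \<epsilon> \<and> (\<forall>i<N. \<delta> i = \<epsilon> i)"
  shows "uncountable A"
proof
  assume "countable A"
  then obtain e :: "nat \<Rightarrow> nat \<Rightarrow> 'a" where e: "range e = A"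
    using range_from_nat_into[OF nonempty] by metis
  define P where "P n s \<longleftrightarrow> fst s \<in> A \<and> n \<le> snd s" for n and s :: "(nat \<Rightarrow> 'a) \<times> nat"
  define Q where "Q n s s' \<longleftrightarrow> snd s \<le> snd s' \<and> (\<forall>i<snd s. fst s' i = fst s i) \<and>
      (\<exists>i<snd s'. fst s' i \<noteq> e n i)" for n and s s' :: "(nat \<Rightarrow> 'a) \<times> nat"
  have "\<exists>f. \<forall>n. P n (f n) \<and> Q n (f n) (f (Suc n))"
  proof (rule dependent_nat_choice)
    obtain \<epsilon> where "\<epsilon> \<in> A"
      using nonempty by blast
    then show "\<exists>s. P 0 s"
      by (auto simp: P_def)
  next
    fix s n
    assume s: "P n s"
    obtain \<delta> where \<delta>: "\<delta> \<in> A" "\<delta> \<noteq> e n" "\<forall>i<snd s. \<delta> i = fst s i"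
      using s perfect[of "fst s" "snd s"] by (metis P_def)
    obtain j where "\<delta> j \<noteq> e n j"
      using \<delta>(2) by blast
    then have "P (Suc n) (\<delta>, Suc (max j (snd s))) \<and> Q n s (\<delta>, Suc (max j (snd s)))"
      using \<delta> s unfolding P_def Q_def by auto
    then show "\<exists>s'. P (Suc n) s' \<and> Q n s s'"
      by blast
  qed
  then obtain f where f: "\<And>n. P n (f n)" "\<And>n. Q n (f n) (f (Suc n))"
    by blast
  have agree: "n \<le> n' \<Longrightarrow> snd (f n) \<le> snd (f n') \<and> (\<forall>i<snd (f n). fst (f n') i = fst (f n) i)" for n n'
  proof (induction n' rule: dec_induct)
    case (step j)
    then show ?case
      using f(2)[of j] unfolding Q_def by auto
  qed auto
  \<comment> \<open>At stage \<open>n\<close> at least \<open>n\<close> entries are fixed, so entry \<open>i\<close> is final from stage \<open>Suc i\<close> on.\<close>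
  define \<epsilon> where "\<epsilon> i = fst (f (Suc i)) i" for i
  have \<epsilon>: "\<epsilon> i = fst (f n) i" if "i < snd (f n)" for i n
  proof -
    have "i < snd (f (Suc i))"
      using f(1)[of "Suc i"] by (auto simp: P_def)
    then show ?thesis
      using that agree[of n "Suc i"] agree[of "Suc i" n] unfolding \<epsilon>_def
      by (metis nat_le_linear)
  qed
  have "\<epsilon> \<in> A"
  proof (rule closed)
    fix N
    show "\<exists>\<delta>\<in>A. \<forall>i<N. \<delta> i = \<epsilon> i"
      using f(1)[of N] \<epsilon>[of _ N] by (intro bexI[of _ "fst (f N)"]) (auto simp: P_def)
  qed
  then obtain n where "\<epsilon> = e n"
    using e by blast
  then show False
    using f(2)[of n] \<epsilon>[of _ "Suc n"] unfolding Q_def by metis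
qed

lemma infinite_if_sequence_accumulates:
  fixes A :: "(nat \<Rightarrow> 'a) set"
  assumes "\<And>N. \<exists>\<delta>\<in>A. \<delta> \<noteq> \<epsilon> \<and> (\<forall>i<N. \<delta> i = \<epsilon> i)"
  shows "infinite A"
proof
  assume fin: "finite A"
  obtain j where j: "\<And>\<delta>. \<delta> \<noteq> \<epsilon> \<Longrightarrow> \<delta> (j \<delta>) \<noteq> \<epsilon> (j \<delta>)"
    by (metis ext)
  obtain \<delta> where \<delta>: "\<delta> \<in> A" "\<delta> \<noteq> \<epsilon>" "\<forall>i<Suc (Max (j ` A)). \<delta> i = \<epsilon> i"
    using assms by blast
  have "j \<delta> < Suc (Max (j ` A))"
    using fin \<delta>(1) by (simp add: less_Suc_eq_le)
  then show False
    using \<delta> j by blast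
qed

lemma countable_eventually_periodic:
  fixes p :: nat
  assumes "p > 0"
  shows "countable {\<epsilon> :: nat \<Rightarrow> 'a :: countable. \<exists>N. \<forall>n\<ge>N. \<epsilon> (n + p) = \<epsilon> n}"
proof -
  have "countable {\<epsilon> :: nat \<Rightarrow> 'a. \<forall>n\<ge>N. \<epsilon> (n + p) = \<epsilon> n}" for N
  proof -
    let ?A = "{\<epsilon> :: nat \<Rightarrow> 'a. \<forall>n\<ge>N. \<epsilon> (n + p) = \<epsilon> n}"
    show "countable ?A"
    proof (rule countable_image_inj_on)
      show "countable ((\<lambda>\<epsilon>. map \<epsilon> [0..<N + p]) ` ?A)"
        by (rule countableI_type)
      show "inj_on (\<lambda>\<epsilon>. map \<epsilon> [0..<N + p]) ?A"
      proof (intro inj_onI ext)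
        fix \<epsilon> \<delta> :: "nat \<Rightarrow> 'a" and n
        assume *: "\<epsilon> \<in> ?A" "\<delta> \<in> ?A" "map \<epsilon> [0..<N + p] = map \<delta> [0..<N + p]"
        show "\<epsilon> n = \<delta> n"
        proof (induction n rule: less_induct)
          case (less n)
          show ?case
          proof (cases "n < N + p")
            case True
            then show ?thesis
              using *(3) by auto
          next
            case False
            then have "\<epsilon> (n - p) = \<delta> (n - p)" "N \<le> n - p" "n = n - p + p"
              using assms by (auto intro!: less)
            moreover from this have "\<epsilon> (n - p + p) = \<epsilon> (n - p)" "\<delta> (n - p + p) = \<delta> (n - p)"
              using *(1,2) by blast+
            ultimately show ?thesis
              by simp
          qed
        qed
      qed
    qed
  qed
  then have "countable (\<Union>N. {\<epsilon> :: nat \<Rightarrow> 'a. \<forall>n\<ge>N. \<epsilon> (n + p) = \<epsilon> n})"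
    by simp
  then show ?thesis
    by (rule countable_subset[rotated]) auto
qed

section \<open>Branching of expansions\<close>

locale generalized_golden_ratio =
  fixes k m :: nat and \<beta> :: real
  assumes m: "m = 2 * k + 1" and square: "\<beta> * \<beta> = (real k + 1) * (\<beta> + 1)" and pos: "\<beta> > 0"
begin

abbreviation L :: real where "L \<equiv> \<beta> - real k"

lemma L_bounds: "1 < L" "L < 2"
proof -
  have eq: "\<beta> * (\<beta> - (real k + 1)) = real k + 1"
    using square by (simp add: algebra_simps)
  show "1 < L"
    using eq pos zero_less_mult_pos[of \<beta> "\<beta> - (real k + 1)"] by simp
  show "L < 2"
  proof (rule ccontr)
    assume "\<not> L < 2"
    then have "\<beta> * 1 \<le> \<beta> * (\<beta> - (real k + 1))"
      using pos by (intro mult_left_mono) auto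
    then show False
      using eq \<open>\<not> L < 2\<close> by simp
  qed
qed

lemma \<beta>_gt_1: "1 < \<beta>"
  using L_bounds by simp

lemma \<beta>_L: "\<beta> * L = real m + L"
  using square m by (simp add: algebra_simps)

lemma max_value_eq: "real m / (\<beta> - 1) = L"
  using \<beta>_L \<beta>_gt_1 by (simp add: field_simps)

lemma expansions_iff:
  "\<epsilon> \<in> expansions \<beta> m x \<longleftrightarrow> (\<forall>i. \<epsilon> i \<le> m) \<and> (\<forall>n. remainder \<beta> \<epsilon> x n \<in> {0..L})"
  using expansions_iff_remainders[OF \<beta>_gt_1, of \<epsilon> m x] unfolding max_value_eq .

lemma interior_digit:
  assumes "y \<in> {0<..<L}"
  shows "\<exists>i\<le>m. \<beta> * y - real i \<in> {0<..<L}"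
proof (cases "\<beta> * y \<le> real m")
  case True
  define i where "i = nat (\<lceil>\<beta> * y\<rceil> - 1)"
  have "0 < \<beta> * y"
    using assms pos by simp
  then have i: "real i = of_int \<lceil>\<beta> * y\<rceil> - 1"
    unfolding i_def by (subst of_nat_nat) auto
  have "\<beta> * y - real i > 0" "\<beta> * y - real i \<le> 1"
    unfolding i by linarith+
  moreover have "i \<le> m"
    using True calculation by linarith
  ultimately show ?thesis
    using L_bounds by (intro exI[of _ i]) auto
next
  case False
  have "\<beta> * y < \<beta> * L"
    using assms pos by simp
  then show ?thesis
    using False \<beta>_L by (intro exI[of _ m]) auto
qed

lemma interior_expansion:
  assumes "x \<in> {0<..<L}"
  obtains \<epsilon> where "\<epsilon> \<in> expansions \<beta> m x" "\<And>n. remainder \<beta> \<epsilon> x n \<in> {0<..<L}"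
proof -
  obtain \<epsilon> where \<epsilon>: "\<And>i. \<epsilon> i \<le> m" "\<And>n. remainder \<beta> \<epsilon> x n \<in> {0<..<L}"
    using digits_remaining_in[OF interior_digit assms] by blast
  moreover from this have "\<epsilon> \<in> expansions \<beta> m x"
    by (auto simp: expansions_iff less_imp_le)
  ultimately show ?thesis
    by (intro that)
qed

lemma expansions_nonempty:
  assumes "x \<in> {0..L}"
  shows "expansions \<beta> m x \<noteq> {}"
proof -
  have "\<exists>i\<le>m. \<beta> * y - real i \<in> {0..L}" if y: "y \<in> {0..L}" for y
  proof -
    consider "y = 0" | "y = L" | "y \<in> {0<..<L}"
      using y by fastforce
    then show ?thesis
    proof cases
      case 1
      then show ?thesis
        using L_bounds by (intro exI[of _ 0]) auto
    next
      case 2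
      then show ?thesis
        using L_bounds \<beta>_L by (intro exI[of _ m]) auto
    next
      case 3
      then show ?thesis
        using interior_digit by (meson atLeastAtMost_iff greaterThanLessThan_iff less_imp_le)
    qed
  qed
  then obtain \<epsilon> where "\<And>i. \<epsilon> i \<le> m" "\<And>n. remainder \<beta> \<epsilon> x n \<in> {0..L}"
    using digits_remaining_in assms by blast
  then show ?thesis
    using expansions_iff by blast
qed

text \<open>
  The range \<open>{1..L}\<close> says that both digits \<open>i\<close> and \<open>Suc i\<close> leave a remainder in \<open>{0..L}\<close>.
\<close>

definition branching :: "real \<Rightarrow> bool" where
  "branching y \<longleftrightarrow> (\<exists>i<m. \<beta> * y - real i \<in> {1..L})"

lemma branching_reflect:
  assumes "branching y"
  shows "branching (L - y)"
proof -
  obtain i where i: "i < m" "\<beta> * y - real i \<in> {1..L}"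
    using assms by (auto simp: branching_def)
  have "\<beta> * (L - y) - real (m - Suc i) = L + 1 - (\<beta> * y - real i)"
    using i(1) \<beta>_L by (simp add: of_nat_diff right_diff_distrib)
  then show ?thesis
    using i unfolding branching_def by (intro exI[of _ "m - Suc i"]) auto
qed

text \<open>
  If \<open>w = \<beta> * y - d\<close> is at most \<open>L - 1\<close> or at least \<open>1\<close>, then \<open>d - 1\<close> or \<open>d + 1\<close> could replace \<open>d\<close>;
  the bounds on \<open>y\<close> guarantee that this is again a digit. Otherwise \<open>L - 1 < w < 1\<close>, and then both
  \<open>k\<close> and \<open>k + 1\<close> can follow because \<open>\<beta> * (L - 1) = k + 1\<close>.
\<close>

lemma branching_soon_in_middle:
  assumes "1 / \<beta> \<le> y" "y \<le> L - 1 / \<beta>" "d \<le> m" "\<beta> * y - real d \<in> {0<..<L}"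
  shows "branching y \<or> branching (\<beta> * y - real d)"
proof (rule disjCI)
  assume *: "\<not> branching (\<beta> * y - real d)"
  define w where "w = \<beta> * y - real d"
  have w: "0 < w" "w < L" and \<beta>y: "1 \<le> \<beta> * y" "\<beta> * y \<le> \<beta> * L - 1"
    using assms pos by (auto simp: w_def field_simps)
  show "branching y"
  proof (cases "w \<le> L - 1 \<or> 1 \<le> w")
    case True
    then consider "w \<le> L - 1" "d \<ge> 1" | "1 \<le> w" "d < m" | "w \<le> L - 1" "d = 0" | "1 \<le> w" "d = m"
      using assms(3) by linarith
    then show ?thesis
    proof cases
      case 1
      then show ?thesis
        using w assms(3) unfolding branching_def w_def
        by (intro exI[of _ "d - 1"]) (auto simp: of_nat_diff)
    next
      case 2
      then show ?thesis
        using w unfolding branching_def w_def by auto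
    next
      case 3
      then show ?thesis
        using \<beta>y L_bounds by (auto simp: w_def)
    next
      case 4
      then show ?thesis
        using \<beta>y L_bounds \<beta>_L by (auto simp: w_def)
    qed
  next
    case False
    have "\<beta> * (L - 1) < \<beta> * w" "\<beta> * w < \<beta> * 1"
      using False pos by auto
    moreover have "\<beta> * (L - 1) = real k + 1"
      using \<beta>_L m by (simp add: right_diff_distrib)
    ultimately have "branching w"
      unfolding branching_def using False m by (intro exI[of _ k]) auto
    with * show ?thesis
      by (simp add: w_def)
  qed
qed

text \<open>
  Below \<open>1 / \<beta>\<close> only the digit 0 is possible, so the orbit grows geometrically; it cannot jump over
  the middle region because \<open>1 \<le> L - 1 / \<beta>\<close>.
\<close>

lemma low_orbit_branches:
  assumes step: "\<And>n. d n \<le> m" "\<And>n. z (Suc n) = \<beta> * z n - real (d n)"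
    and inside: "\<And>n. z n \<in> {0<..<L}" and low: "z 0 < 1 / \<beta>"
  shows "\<exists>n. branching (z n)"
proof (rule ccontr)
  assume *: "\<nexists>n. branching (z n)"
  have middle: "\<not> (1 / \<beta> \<le> z n \<and> z n \<le> L - 1 / \<beta>)" for n
    using branching_soon_in_middle[of "z n" "d n"] step inside[of "Suc n"] * by metis
  have "\<beta> * (L - 1) = real k + 1"
    using \<beta>_L m by (simp add: right_diff_distrib)
  then have "1 / \<beta> \<le> L - 1"
    using pos by (simp add: field_simps)
  have "z n = \<beta> ^ n * z 0 \<and> z n < 1 / \<beta>" for n
  proof (induction n)
    case (Suc n)
    then have "z n < 1 / \<beta>"
      by blast
    then have "\<beta> * z n < 1"
      using pos by (simp add: field_simps)
    moreover have "\<beta> * z n - real (d n) > 0"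
      using step(2)[of n] inside[of "Suc n"] by simp
    ultimately have "d n = 0"
      by linarith
    then have "z (Suc n) = \<beta> * z n"
      using step(2) by simp
    moreover from this have "z (Suc n) < 1 / \<beta>"
      using \<open>\<beta> * z n < 1\<close> middle[of "Suc n"] \<open>1 / \<beta> \<le> L - 1\<close> by linarith
    ultimately show ?case
      using Suc by simp
  qed (use low in simp)
  then have bound: "\<beta> ^ n * z 0 < 1 / \<beta>" for n
    by metis
  obtain n where "1 / \<beta> / z 0 < \<beta> ^ n"
    using real_arch_pow[OF \<beta>_gt_1] by blast
  then show False
    using bound[of n] inside[of 0] by (simp add: field_simps)
qed

lemma interior_orbit_branches:
  assumes step: "\<And>n. d n \<le> m" "\<And>n. z (Suc n) = \<beta> * z n - real (d n)"
    and inside: "\<And>n. z n \<in> {0<..<L}"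
  shows "\<exists>n. branching (z n)"
proof -
  consider "z 0 < 1 / \<beta>" | "L - z 0 < 1 / \<beta>" | "1 / \<beta> \<le> z 0" "z 0 \<le> L - 1 / \<beta>"
    by linarith
  then show ?thesis
  proof cases
    case 1
    then show ?thesis
      using low_orbit_branches[of d z] step inside by blast
  next
    case 2
    have "\<exists>n. branching (L - z n)"
    proof (rule low_orbit_branches[of "\<lambda>n. m - d n"])
      show "L - z (Suc n) = \<beta> * (L - z n) - real (m - d n)" for n
        using step[of n] \<beta>_L by (simp add: of_nat_diff right_diff_distrib)
    qed (use 2 inside in auto)
    then show ?thesis
      using branching_reflect by fastforce
  next
    case 3
    then show ?thesis
      using branching_soon_in_middle[of "z 0" "d 0"] step inside[of "Suc 0"] by metis
  qed
qed

text \<open>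
  The orbit from \<open>N\<close> on meets a branching remainder. There one of the two admissible digits differs
  from the one used, and whatever remains in \<open>{0..L}\<close> can be expanded further.
\<close>

lemma nearby_expansion:
  assumes \<epsilon>: "\<epsilon> \<in> expansions \<beta> m x" and inside: "\<And>n. remainder \<beta> \<epsilon> x n \<in> {0<..<L}"
  shows "\<exists>\<delta>\<in>expansions \<beta> m x. \<delta> \<noteq> \<epsilon> \<and> (\<forall>i<N. \<delta> i = \<epsilon> i)"
proof -
  have dig: "\<epsilon> i \<le> m" for i
    using \<epsilon> by (simp add: expansions_iff)
  have "\<exists>n. branching (remainder \<beta> \<epsilon> x (N + n))"
    using inside dig by (intro interior_orbit_branches[of "\<lambda>n. \<epsilon> (N + n)"]) auto
  then obtain t where t: "N \<le> t" "branching (remainder \<beta> \<epsilon> x t)"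
    using le_add1 by blast
  define y where "y = remainder \<beta> \<epsilon> x t"
  obtain i where i: "i < m" "\<beta> * y - real i \<in> {1..L}"
    using t(2) by (auto simp: branching_def y_def)
  define d where "d = (if \<epsilon> t = i then Suc i else i)"
  have d: "d \<noteq> \<epsilon> t" "d \<le> m" "\<beta> * y - real d \<in> {0..L}"
    using i by (auto simp: d_def)
  obtain \<gamma> where "\<gamma> \<in> expansions \<beta> m (\<beta> * y - real d)"
    using expansions_nonempty[OF d(3)] by blast
  then have "case_nat d \<gamma> \<in> expansions \<beta> m y"
    using d(2) inside[of t] unfolding y_def
    by (intro expansion_Cons[OF \<beta>_gt_1]) (auto simp: max_value_eq)
  then have "(\<lambda>i. if i < t then \<epsilon> i else case_nat d \<gamma> (i - t)) \<in> expansions \<beta> m x" (is "?\<delta> \<in> _")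
    unfolding y_def by (rule splice_expansion[OF \<beta>_gt_1 \<epsilon>])
  moreover have "?\<delta> \<noteq> \<epsilon>"
    using d(1) fun_cong[of ?\<delta> \<epsilon> t] by auto
  moreover have "\<forall>i<N. ?\<delta> i = \<epsilon> i"
    using t(1) by auto
  ultimately show ?thesis
    by blast
qed

lemma infinite_expansions:
  assumes "x \<in> {0<..<L}"
  shows "infinite (expansions \<beta> m x)"
proof -
  obtain \<epsilon> where "\<epsilon> \<in> expansions \<beta> m x" "\<And>n. remainder \<beta> \<epsilon> x n \<in> {0<..<L}"
    using interior_expansion[OF assms] by blast
  then show ?thesis
    using nearby_expansion by (intro infinite_if_sequence_accumulates[of _ \<epsilon>]) blast
qed

section \<open>Points outside the ring generated by the base\<close>

text \<open>
  Because \<open>\<beta> * \<beta> = (k + 1) * (\<beta> + 1)\<close>, these are exactly the elements of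
  \<open>\<int>[\<beta>, 1 / (k + 1)]\<close>, and \<open>\<beta>\<close> is a unit of this ring.
\<close>

definition base_ring :: "real set" where
  "base_ring = {y. \<exists>(n::nat) (p::int) (q::int). (real k + 1) ^ n * y = of_int p * \<beta> + of_int q}"

lemma base_ring_eq:
  "base_ring = {(of_int p * \<beta> + of_int q) / (real k + 1) powi n | n p q :: int. True}"
proof (intro equalityI subsetI)
  fix y assume "y \<in> base_ring"
  then obtain n :: nat and p q :: int where "(real k + 1) ^ n * y = of_int p * \<beta> + of_int q"
    unfolding base_ring_def by blast
  then have "y = (of_int p * \<beta> + of_int q) / (real k + 1) powi int n"
    by (simp add: eq_divide_eq mult.commute)
  then show "y \<in> {(of_int p * \<beta> + of_int q) / (real k + 1) powi n | n p q :: int. True}"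
    by blast
next
  fix y assume "y \<in> {(of_int p * \<beta> + of_int q) / (real k + 1) powi n | n p q :: int. True}"
  then obtain n p q :: int where y: "y = (of_int p * \<beta> + of_int q) / (real k + 1) powi n"
    by blast
  show "y \<in> base_ring"
  proof (cases "n \<ge> 0")
    case True
    then have "(real k + 1) ^ nat n * y = of_int p * \<beta> + of_int q"
      using y by (simp add: power_int_def)
    then show ?thesis
      unfolding base_ring_def by blast
  next
    case False
    define c where "c = (int k + 1) ^ nat (- n)"
    have "y = (of_int p * \<beta> + of_int q) * (real k + 1) ^ nat (- n)"
      using y False by (simp add: power_int_def field_simps)
    then have "(real k + 1) ^ 0 * y = of_int (p * c) * \<beta> + of_int (q * c)"
      by (simp add: c_def algebra_simps)
    then show ?thesis
      unfolding base_ring_def by blast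
  qed
qed

lemma base_ring_preimage:
  assumes "\<beta> * y - real i \<in> base_ring"
  shows "y \<in> base_ring"
proof -
  obtain n :: nat and p q :: int
    where *: "(real k + 1) ^ n * (\<beta> * y - real i) = of_int p * \<beta> + of_int q"
    using assms unfolding base_ring_def by blast
  define c where "c = q + (int k + 1) ^ n * int i"
  have "(real k + 1) ^ n * (\<beta> * y) = of_int p * \<beta> + of_int c"
    using * by (simp add: c_def algebra_simps)
  then have "\<beta> * ((real k + 1) ^ Suc n * y) = (real k + 1) * (of_int p * \<beta> + of_int c)"
    by (simp add: mult_ac)
  \<comment> \<open>Divide by \<open>\<beta>\<close>, using that its inverse is \<open>(\<beta> - (k + 1)) / (k + 1)\<close>.\<close>
  also have "\<dots> = (real k + 1) * of_int p * \<beta> + of_int c * (real k + 1)"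
    by (simp add: algebra_simps)
  also have "of_int c * (real k + 1) = of_int c * (\<beta> * (\<beta> - (real k + 1)))"
    using square by (simp add: algebra_simps)
  also have "(real k + 1) * of_int p * \<beta> + \<dots> =
      \<beta> * ((real k + 1) * of_int p + (\<beta> - (real k + 1)) * of_int c)"
    by (simp add: algebra_simps)
  finally have "(real k + 1) ^ Suc n * y = (real k + 1) * of_int p + (\<beta> - (real k + 1)) * of_int c"
    using pos by simp
  then have "(real k + 1) ^ Suc n * y = of_int c * \<beta> + of_int ((int k + 1) * (p - c))"
    by (simp add: algebra_simps)
  then show ?thesis
    unfolding base_ring_def by blast
qed

lemma endpoints_in_base_ring: "0 \<in> base_ring" "L \<in> base_ring"
proof -
  have "(real k + 1) ^ 0 * 0 = of_int 0 * \<beta> + of_int 0"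
    "(real k + 1) ^ 0 * L = of_int 1 * \<beta> + of_int (- int k)"
    by simp_all
  then show "0 \<in> base_ring" "L \<in> base_ring"
    unfolding base_ring_def by blast+
qed

lemma uncountable_expansions:
  assumes "x \<in> {0<..<L}" "x \<notin> base_ring"
  shows "uncountable (expansions \<beta> m x)"
proof -
  have perfect: "\<exists>\<delta>\<in>expansions \<beta> m x. \<delta> \<noteq> \<epsilon> \<and> (\<forall>i<N. \<delta> i = \<epsilon> i)"
    if \<epsilon>: "\<epsilon> \<in> expansions \<beta> m x" for \<epsilon> N
  proof (rule nearby_expansion[OF \<epsilon>])
    fix n
    have "remainder \<beta> \<epsilon> x n \<notin> base_ring"
      by (induction n) (use assms(2) base_ring_preimage in auto)
    then have "remainder \<beta> \<epsilon> x n \<noteq> 0" "remainder \<beta> \<epsilon> x n \<noteq> L"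
      using endpoints_in_base_ring by metis+
    moreover have "remainder \<beta> \<epsilon> x n \<in> {0..L}"
      using \<epsilon> expansions_iff by blast
    ultimately show "remainder \<beta> \<epsilon> x n \<in> {0<..<L}"
      by auto
  qed
  have nonempty: "expansions \<beta> m x \<noteq> {}"
    using assms(1) by (intro expansions_nonempty) auto
  show ?thesis
    by (rule uncountable_perfect_sequence_set[OF nonempty expansions_closed[OF \<beta>_gt_1] perfect])
qed

section \<open>Points of the ring\<close>

text \<open>
  Two digits clear one factor \<open>k + 1\<close> of the denominator, because \<open>\<beta> * \<beta>\<close> is divisible by \<open>k + 1\<close>
  in \<open>\<int>[\<beta>]\<close>.
\<close>

lemma remainder_integral:
  assumes "(real k + 1) ^ n * x = of_int p * \<beta> + of_int q"
  shows "\<exists>p q :: int. remainder \<beta> \<epsilon> x (2 * n) = of_int p * \<beta> + of_int q"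
  using assms
proof (induction n arbitrary: x p q \<epsilon>)
  case 0
  then have "remainder \<beta> \<epsilon> x (2 * 0) = of_int p * \<beta> + of_int q"
    by simp
  then show ?case
    by blast
next
  case (Suc n)
  define y where "y = remainder \<beta> \<epsilon> x 2"
  define c where "c = (int k + 1) ^ n"
  have "y = \<beta> * \<beta> * x - \<beta> * real (\<epsilon> 0) - real (\<epsilon> 1)"
    by (simp add: y_def numeral_2_eq_2 algebra_simps)
  then have y: "y = (real k + 1) * (\<beta> + 1) * x - \<beta> * real (\<epsilon> 0) - real (\<epsilon> 1)"
    unfolding square .
  have "(real k + 1) ^ n * y =
      (\<beta> + 1) * ((real k + 1) ^ Suc n * x) - of_int c * (\<beta> * real (\<epsilon> 0) + real (\<epsilon> 1))"
    unfolding y c_def by (simp add: algebra_simps)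
  also have "\<dots> = of_int p * (\<beta> * \<beta>) + of_int (p + q) * \<beta> + of_int q
      - of_int c * (\<beta> * real (\<epsilon> 0) + real (\<epsilon> 1))"
    unfolding Suc.prems by (simp add: algebra_simps)
  also have "\<dots> = of_int ((int k + 1) * p + p + q - c * int (\<epsilon> 0)) * \<beta>
      + of_int ((int k + 1) * p + q - c * int (\<epsilon> 1))"
    unfolding square by (simp add: algebra_simps)
  finally have "\<exists>p q :: int. remainder \<beta> (\<lambda>i. \<epsilon> (2 + i)) y (2 * n) = of_int p * \<beta> + of_int q"
    by (rule Suc.IH)
  then show ?case
    using remainder_add[of \<beta> \<epsilon> x 2 "2 * n"] by (simp add: y_def)
qed

text \<open>
  Write \<open>z n = p n * \<beta> + q n\<close> with integers \<open>p n\<close> and \<open>q n\<close>. The next coefficient is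
  \<open>p (Suc n) = (k + 1) * p n + q n = z n - (L - 1) * p n\<close>, where \<open>L - 1 < 1\<close> is minus the conjugate
  of \<open>\<beta>\<close>. Since \<open>z n\<close> lies in \<open>{0..L}\<close>, integrality of \<open>p\<close> makes \<open>\<bar>2 * p - 1\<bar>\<close> nonincreasing,
  hence eventually constant, and then \<open>p\<close> either stays put, which happens only at the fixed points
  \<open>0\<close> and \<open>L\<close>, or alternates with \<open>1 - p\<close>. In both cases \<open>z\<close> has period 2 from
  there on, and so do the digits.
\<close>

lemma integral_orbit_eventually_periodic:
  assumes step: "\<And>n. d n \<le> m" "\<And>n. z (Suc n) = \<beta> * z n - real (d n)"
    and inside: "\<And>n. z n \<in> {0..L}" and start: "z 0 = of_int p0 * \<beta> + of_int q0"
  shows "\<exists>N. \<forall>n\<ge>N. d (n + 2) = d n"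
proof -
  define c where "c = L - 1"
  have c: "0 < c" "c < 1"
    using L_bounds by (auto simp: c_def)
  have z: "0 \<le> z n" "z n \<le> 1 + c" for n
    using inside[of n] by (auto simp: c_def)
  have "\<exists>p. \<forall>n. (\<exists>q::int. z n = of_int (p n) * \<beta> + of_int q) \<and>
      of_int (p (Suc n)) = z n - c * of_int (p n :: int)"
  proof (rule dependent_nat_choice)
    show "\<exists>p q :: int. z 0 = of_int p * \<beta> + of_int q"
      using start by blast
  next
    fix p :: int and n
    assume "\<exists>q::int. z n = of_int p * \<beta> + of_int q"
    then obtain q :: int where q: "z n = of_int p * \<beta> + of_int q" ..
    have "z (Suc n) = of_int ((int k + 1) * p + q) * \<beta> + of_int ((int k + 1) * p - int (d n))"
    proof -
      have "z (Suc n) = of_int p * (\<beta> * \<beta>) + of_int q * \<beta> - real (d n)"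
        unfolding step(2) q by (simp add: algebra_simps)
      then show ?thesis
        unfolding square by (simp add: algebra_simps)
    qed
    moreover have "of_int ((int k + 1) * p + q) = z n - c * of_int p"
      unfolding q c_def by (simp add: algebra_simps)
    ultimately show "\<exists>p'. (\<exists>q::int. z (Suc n) = of_int p' * \<beta> + of_int q) \<and>
        of_int p' = z n - c * of_int p"
      by blast
  qed
  then obtain p :: "nat \<Rightarrow> int" where p: "\<And>n. of_int (p (Suc n)) = z n - c * of_int (p n)"
    by blast
  have bounds: "1 - p n \<le> p (Suc n) \<and> p (Suc n) \<le> 1 \<and> p n \<ge> 1 \<or>
      0 \<le> p (Suc n) \<and> p (Suc n) \<le> 1 - p n \<and> p n \<le> 0" for n
  proof (cases "p n \<ge> 1")
    case True
    have "c * 1 \<le> c * real_of_int (p n)" "c * real_of_int (p n) < 1 * real_of_int (p n)"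
      using c True by (intro mult_left_mono mult_strict_right_mono; simp)+
    then have "real_of_int (p (Suc n)) \<le> 1" "real_of_int (p (Suc n)) > - real_of_int (p n)"
      using p[of n] z[of n] by linarith+
    then show ?thesis
      using True by linarith
  next
    case False
    have "c * (1 - real_of_int (p n)) < 1 * (1 - real_of_int (p n))"
      using c False by (intro mult_strict_right_mono) auto
    then have "c - c * real_of_int (p n) < 1 - real_of_int (p n)"
      by (simp add: right_diff_distrib)
    moreover have "c * real_of_int (p n) \<le> 0"
      using c False by (intro mult_nonneg_nonpos) auto
    ultimately have "real_of_int (p (Suc n)) \<ge> 0" "real_of_int (p (Suc n)) < 2 - real_of_int (p n)"
      using p[of n] z[of n] by linarith+
    then show ?thesis
      using False by linarith
  qed
  have noninc: "\<bar>2 * p (Suc n) - 1\<bar> \<le> \<bar>2 * p n - 1\<bar>" for n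
    using bounds[of n] by linarith
  define u where "u n = nat \<bar>2 * p n - 1\<bar>" for n
  have "decseq u"
    using noninc by (intro decseq_SucI) (auto simp: u_def intro!: nat_mono)
  obtain N where N: "\<And>n. u N \<le> u n"
    using ex_has_least_nat[of "\<lambda>_. True" 0 u] by auto
  have const: "u n = u N" if "N \<le> n" for n
    using N[of n] decseqD[OF \<open>decseq u\<close> that] by simp
  have cases: "p (Suc n) = p n \<or> p (Suc n) = 1 - p n" if "N \<le> n" for n
    using const[of n] const[of "Suc n"] that by (auto simp: u_def)
  have "\<exists>M. \<forall>n\<ge>M. z (n + 2) = z n"
  proof (cases "\<exists>n\<ge>N. p (Suc n) = p n")
    case True
    then obtain n where n: "p (Suc n) = p n"
      by blast
    then have zn: "z n = L * of_int (p n)"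
      using p[of n] by (simp add: c_def algebra_simps)
    then have "0 \<le> L * of_int (p n)" "L * of_int (p n) \<le> L * 1"
      using inside[of n] by auto
    then have "0 \<le> p n" "p n \<le> 1"
      using L_bounds by (simp_all add: zero_le_mult_iff mult_le_cancel_left)
    then have zn: "z n = 0 \<or> z n = L"
      using zn by (cases "p n = 0") auto
    have "z j = z n" if "n \<le> j" for j
      using that
    proof (induction j rule: dec_induct)
      case (step j)
      have "z (Suc j) = \<beta> * z n - real (d j)"
        using assms(2)[of j] step.IH by simp
      then show ?case
        using zn inside[of "Suc j"] \<beta>_L assms(1)[of j] by auto
    qed simp
    then show ?thesis
      by (metis le_add1 le_trans)
  next
    case False
    then have "p (Suc n) = 1 - p n" if "N \<le> n" for n
      using cases that by blast
    then have "p (n + 2) = p n" if "N \<le> n" for n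
      using that by (simp add: numeral_2_eq_2)
    then have "z (n + 2) = z n" if "N \<le> n" for n
      using p[of n] p[of "n + 2"] that by (metis add_Suc add_right_cancel diff_add_cancel le_SucI)
    then show ?thesis
      by blast
  qed
  then obtain M where M: "\<And>n. M \<le> n \<Longrightarrow> z (n + 2) = z n"
    by blast
  have "d (n + 2) = d n" if "M \<le> n" for n
    using step(2)[of n] step(2)[of "n + 2"] M[of n] M[of "Suc n"] that by simp
  then show ?thesis
    by blast
qed

lemma countable_expansions:
  assumes "x \<in> base_ring"
  shows "countable (expansions \<beta> m x)"
proof (rule countable_subset)
  show "countable {\<epsilon> :: nat \<Rightarrow> nat. \<exists>N. \<forall>n\<ge>N. \<epsilon> (n + 2) = \<epsilon> n}"
    by (rule countable_eventually_periodic) simp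
  show "expansions \<beta> m x \<subseteq> {\<epsilon>. \<exists>N. \<forall>n\<ge>N. \<epsilon> (n + 2) = \<epsilon> n}"
  proof
    fix \<epsilon> assume \<epsilon>: "\<epsilon> \<in> expansions \<beta> m x"
    obtain n :: nat and p q :: int where "(real k + 1) ^ n * x = of_int p * \<beta> + of_int q"
      using assms unfolding base_ring_def by blast
    then obtain t and p' q' :: int where "remainder \<beta> \<epsilon> x t = of_int p' * \<beta> + of_int q'"
      using remainder_integral by metis
    then have "\<exists>N. \<forall>n\<ge>N. \<epsilon> (t + (n + 2)) = \<epsilon> (t + n)"
      using \<epsilon> unfolding expansions_iff
      by (intro integral_orbit_eventually_periodic[of "\<lambda>n. \<epsilon> (t + n)" "\<lambda>n. remainder \<beta> \<epsilon> x (t + n)"])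
        auto
    then obtain N where N: "\<And>n. n \<ge> N \<Longrightarrow> \<epsilon> (t + (n + 2)) = \<epsilon> (t + n)"
      by blast
    have "\<epsilon> (n + 2) = \<epsilon> n" if "n \<ge> t + N" for n
      using N[of "n - t"] that by simp
    then show "\<epsilon> \<in> {\<epsilon>. \<exists>N. \<forall>n\<ge>N. \<epsilon> (n + 2) = \<epsilon> n}"
      by blast
  qed
qed

end

lemma generalized_golden_ratio_root:
  "generalized_golden_ratio k (2 * k + 1) ((real k + 1 + sqrt ((real k)\<^sup>2 + 6 * real k + 5)) / 2)"
proof (unfold_locales, rule refl)
  define s where "s = sqrt ((real k)\<^sup>2 + 6 * real k + 5)"
  have s: "s * s = (real k)\<^sup>2 + 6 * real k + 5" "s \<ge> 0"
    by (simp_all add: s_def)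
  have "(real k + 1 + s) * (real k + 1 + s) = (real k + 1) * (2 * (real k + 1) + 2 * s) + 4 * (real k + 1)"
    using s(1) by (simp add: algebra_simps power2_eq_square)
  then have "(real k + 1 + s) / 2 * ((real k + 1 + s) / 2) = (real k + 1) * ((real k + 1 + s) / 2 + 1)"
    by (simp add: field_simps)
  then show "(real k + 1 + sqrt ((real k)\<^sup>2 + 6 * real k + 5)) / 2 *
      ((real k + 1 + sqrt ((real k)\<^sup>2 + 6 * real k + 5)) / 2) =
      (real k + 1) * ((real k + 1 + sqrt ((real k)\<^sup>2 + 6 * real k + 5)) / 2 + 1)"
    unfolding s_def .
  have "0 < (real k + 1 + s) / 2"
    using s(2) by simp
  then show "0 < (real k + 1 + sqrt ((real k)\<^sup>2 + 6 * real k + 5)) / 2"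
    unfolding s_def .
qed

theorem theorem1p2:
  fixes k m :: nat and \<beta> :: real and S :: "real set"
  assumes "m = 2 * k + 1"
    and "\<beta> = (real k + 1 + sqrt ((real k)\<^sup>2 + 6 * real k + 5)) / 2"
    and "S = {(of_int p * \<beta> + of_int q) / (real k + 1) powi n | n p q :: int. True}
               \<inter> {0<..<real m / (\<beta> - 1)}"
  shows "(\<forall>x\<in>S. expansions \<beta> m x \<approx> (UNIV :: nat set)) \<and>
         (\<forall>x\<in>{0<..<\<beta> - real k} - S. uncountable (expansions \<beta> m x))"
proof -
  interpret generalized_golden_ratio k m \<beta>
    unfolding assms(1,2) by (rule generalized_golden_ratio_root)
  have S: "S = base_ring \<inter> {0<..<\<beta> - real k}"
    using assms(3) max_value_eq base_ring_eq by simp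
  show ?thesis
  proof (intro conjI ballI)
    fix x assume "x \<in> S"
    then have "countable (expansions \<beta> m x)" "infinite (expansions \<beta> m x)"
      using countable_expansions infinite_expansions S by blast+
    then show "expansions \<beta> m x \<approx> (UNIV :: nat set)"
      using to_nat_on_infinite unfolding eqpoll_def by blast
  next
    fix x assume "x \<in> {0<..<\<beta> - real k} - S"
    then show "uncountable (expansions \<beta> m x)"
      using uncountable_expansions S by blast
  qed
qed

end
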